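(* Let $m$ be an odd integer such that $q=2m^2-1$ is a prime power, and let $\omega$ be a primitive element of $\mathbb{F}_{q^2}$, $C_i^{(e,q^2)}=\omega^i\langle\omega^e\rangle$. Let $X_0=\{0\}$ and let $X_1,\dots,X_4$ partition $\mathbb{F}_{q^2}\setminus\{0\}$ such that: (1) $X_1=\omega^{2m^2}X_3$, $X_2=\omega^{2m^2}X_4$; (2) each $X_i$ is a union of cosets of $C_0^{(4m^2,q^2)}$; (3) with $R_i=\{(x,y):x-y\in X_i\}$, $(\mathbb{F}_{q^2},\{R_i\}_{i=0}^4)$ is a four-class association scheme, and there is $\tau\in\{1,-1\}$ such that, setting $Y_0=\{0\}$, $Y_j=\omega^{-m^2\tau}X_j^q$ ($X_j^q=\{x^q:x\in X_j\}$) and $g=G_q(\eta)$, for every $a\in Y_j$ the values $\psi_{\mathbb{F}_{q^2}}(aX_i)=\sum_{x\in X_i}\psi_{\mathbb{F}_{q^2}}(ax)$ for $i=1,2,3,4$ are: - $a\in Y_0$: $m(m^2-1)(m-1)$, $m(m^2-1)(m+1)$, $m(m^2-1)(m-1)$, $m(m^2-1)(m+1)$; - $a\in Y_1$: $\frac{m^2+m-1}{2}-\frac{m}{2}g$, $\frac{-m^2-m}{2}-\frac{m+1}{2}g$, $\frac{m^2+m-1}{2}+\frac{m}{2}g$, $\frac{-m^2-m}{2}+\frac{m+1}{2}g$; - $a\in Y_2$: $\frac{-m^2+m}{2}-\frac{m-1}{2}g$, $\frac{m^2-m-1}{2}+\frac{m}{2}g$, $\frac{-m^2+m}{2}+\frac{m-1}{2}g$,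 $\frac{m^2-m-1}{2}-\frac{m}{2}g$; - $a\in Y_3$: $\frac{m^2+m-1}{2}+\frac{m}{2}g$, $\frac{-m^2-m}{2}+\frac{m+1}{2}g$, $\frac{m^2+m-1}{2}-\frac{m}{2}g$, $\frac{-m^2-m}{2}-\frac{m+1}{2}g$; - $a\in Y_4$: $\frac{-m^2+m}{2}+\frac{m-1}{2}g$, $\frac{m^2-m-1}{2}-\frac{m}{2}g$, $\frac{-m^2+m}{2}-\frac{m-1}{2}g$, $\frac{m^2-m-1}{2}+\frac{m}{2}g$. Let $\ell$ be an integer not divisible by $q+1$ such that $\omega^\ell\in X_2\cup X_4$ and $\omega^{\ell q}-\omega^\ell\in C_{\tau m^2}^{(4m^2,q^2)}$. Let $(S_0,S_1)=(X_1\cup X_4,X_1\cup X_2)$ if $\omega^\ell\in X_2$ and $(S_0,S_1)=(X_2\cup X_3,X_3\cup X_4)$ if $\omega^\ell\in X_4$, and $D_{\ell,S_d}=\{x\in\mathbb{F}_q:1+x\omega^\ell\in S_d\}$, $d=0,1$. Then $|D_{\ell,S_0}|=m^2-m$, $|D_{\ell,S_1}|=m^2$, \[ \{|D_{\ell,S_0}\cap((C_0^{(2,q)}\cup\{0\})+s)|+|D_{\ell,S_1}\cap(C_0^{(2,q)}+s)|: s\in\mathbb{F}_q\}=\{m^2-m,m^2\}, \] and \[ \{|D_{\ell,S_0}\cap(C_0^{(2,q)}+s)|+|D_{\ell,S_1}\cap((\mathbb{F}_q^*\setminus C_0^{(2,q)})+s)|: s\in\mathbb{F}_q\}=\{m^2-m,m^2\},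 \] where $C_0^{(2,q)}$ is the set of nonzero squares of $\mathbb{F}_q$.
   Context: For a prime power $Q=p^f$, the canonical additive character of $\mathbb{F}_Q$ is $\psi_{\mathbb{F}_Q}(x)=\exp(2\pi i\,\mathrm{Tr}_{Q/p}(x)/p)$; for a multiplicative character $\chi$ of $\mathbb{F}_Q$ the Gauss sum is $G_Q(\chi)=\sum_{x\in\mathbb{F}_Q^*}\chi(x)\psi_{\mathbb{F}_Q}(x)$; $\eta$ is the quadratic character of $\mathbb{F}_q$. A $d$-class association scheme on a finite set $X$ is a partition $R_0=\{(x,x)\},R_1,\dots,R_d$ of $X\times X$ such that each transpose of an $R_i$ is some $R_{i'}$ and for all $i,j,k$ the number of $z$ with $(x,z)\in R_i,(z,y)\in R_j$ is the same for all $(x,y)\in R_k$. The subscript $\tau m^2$ of $C_{\tau m^2}^{(4m^2,q^2)}$ is taken modulo $4m^2$. *)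

theory Defs
  imports "HOL-Analysis.Analysis"
begin

text \<open>
  Finite fields are realised inside one ambient finite field type \<open>'a\<close> of characteristic \<open>p\<close>:
  the field with \<open>Q\<close> elements, if contained in \<open>'a\<close>, is the set of roots of \<open>x ^ Q = x\<close>.
\<close>

definition GF :: "nat \<Rightarrow> 'a::field set" where
  "GF Q = {x. x ^ Q = x}"

definition abs_trace :: "nat \<Rightarrow> nat \<Rightarrow> 'a::field \<Rightarrow> 'a" where
  "abs_trace p f x = (\<Sum>i<f. x ^ (p ^ i))"

text \<open>
  For \<open>x\<close> in the field with \<open>p ^ f\<close> elements the trace lies in the prime field, whose elements
  are the \<open>of_nat n\<close> with \<open>n < p\<close>.
\<close>

definition add_char :: "nat \<Rightarrow> nat \<Rightarrow> 'a::field \<Rightarrow> complex" where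
  "add_char p f x =
     exp (2 * of_real pi * \<i> * of_nat (THE n. n < p \<and> of_nat n = abs_trace p f x) / of_nat p)"

definition add_char_sum :: "nat \<Rightarrow> nat \<Rightarrow> 'a::field \<Rightarrow> 'a set \<Rightarrow> complex" where
  "add_char_sum p f a S = (\<Sum>x\<in>S. add_char p f (a * x))"

definition gauss_sum :: "nat \<Rightarrow> nat \<Rightarrow> ('a::field \<Rightarrow> complex) \<Rightarrow> complex" where
  "gauss_sum p f \<theta> = (\<Sum>x\<in>GF (p ^ f) - {0}. \<theta> x * add_char p f x)"

definition nonzero_squares :: "'a::field set \<Rightarrow> 'a set" where
  "nonzero_squares K = {y ^ 2 | y. y \<in> K \<and> y \<noteq> 0}"

definition quadratic_char :: "'a::field set \<Rightarrow> 'a \<Rightarrow> complex" where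
  "quadratic_char K x = (if x = 0 then 0 else if x \<in> nonzero_squares K then 1 else - 1)"

definition primitive_element :: "'a::field \<Rightarrow> bool" where
  "primitive_element \<omega> \<longleftrightarrow> range (\<lambda>k::nat. \<omega> ^ k) = UNIV - {0}"

definition cyclotomic_class :: "'a::field \<Rightarrow> int \<Rightarrow> int \<Rightarrow> 'a set" where
  "cyclotomic_class \<omega> e i = {\<omega> powi i * (\<omega> powi e) powi k | k. True}"

definition translate :: "'a::plus set \<Rightarrow> 'a \<Rightarrow> 'a set" where
  "translate A s = (\<lambda>x. x + s) ` A"

definition association_scheme :: "'b set \<Rightarrow> nat \<Rightarrow> (nat \<Rightarrow> ('b \<times> 'b) set) \<Rightarrow> bool" where
  "association_scheme V d R \<longleftrightarrow>
     finite V \<and>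
     R 0 = {(x, x) | x. x \<in> V} \<and>
     (\<Union>i\<in>{0..d}. R i) = V \<times> V \<and>
     disjoint_family_on R {0..d} \<and>
     (\<forall>i\<in>{0..d}. R i \<noteq> {}) \<and>
     (\<forall>i\<in>{0..d}. \<exists>i'\<in>{0..d}. (R i)\<inverse> = R i') \<and>
     (\<forall>i\<in>{0..d}. \<forall>j\<in>{0..d}. \<forall>k\<in>{0..d}. \<exists>n. \<forall>(x, y)\<in>R k.
        card {z \<in> V. (x, z) \<in> R i \<and> (z, y) \<in> R j} = n)"

end

theory Submission
  imports Defs "HOL-Number_Theory.Residues"
begin

text \<open>
  Put \<open>L = \<omega> powi l\<close> and let \<open>h\<close> be one of the signed indicators \<open>1\<^bsub>X 1\<^esub> - 1\<^bsub>X 3\<^esub>\<close> and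
  \<open>1\<^bsub>X 2\<^esub> - 1\<^bsub>X 4\<^esub>\<close>. Both satisfy \<open>h (c z) = \<eta> c * h z\<close> for \<open>c\<close> in the subfield \<open>K\<close> of order \<open>q\<close>.
  If \<open>Tr (b v) = 0\<close> and \<open>Tr (b u) = 1\<close>, writing \<open>z = t u + y v\<close> with \<open>t, y \<in> K\<close> factors the
  Fourier coefficient of \<open>h\<close> at \<open>b\<close> as the Gauss sum times the sum of \<open>h\<close> over the affine line
  \<open>u + K v\<close>. Since the Gauss sum is nonzero, the hypothesised table gives all these line sums, with
  \<open>b = v ^ q / (L ^ q - L)\<close> up to sign, which lies in \<open>Y j\<close> whenever \<open>v \<in> X j\<close>. The line \<open>1 + K L\<close>
  gives the cardinalities; the substitution \<open>x = s + 1 / y\<close> turns the sum of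
  \<open>h (1 + x L) * \<eta> (x - s)\<close> into a sum over the line \<open>L + K (1 + s L)\<close>, which gives the
  intersection numbers with the translates of the squares.
\<close>

section \<open>Finite fields: Fermat's identity and the prime field\<close>

lemma power_card_minus_one_eq_one:
  fixes x :: "'a::{field,finite}"
  assumes "x \<noteq> 0"
  shows "x ^ (CARD('a) - 1) = 1"
proof -
  \<comment> \<open>Multiplication by \<open>x\<close> permutes the nonzero elements.\<close>
  have "(\<Prod>y\<in>UNIV - {0}. x * y) = (\<Prod>y\<in>UNIV - {0}. y)"
    by (rule prod.reindex_bij_witness[of _ "\<lambda>y. y / x" "\<lambda>y. x * y"]) (use assms in auto)
  moreover have "(\<Prod>y\<in>UNIV - {0}. x * y) = x ^ (CARD('a) - 1) * (\<Prod>y\<in>UNIV - {0}. y)"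
    by (simp add: prod.distrib card_Diff_singleton)
  moreover have "(\<Prod>y\<in>UNIV - {0::'a}. y) \<noteq> 0"
    by simp
  ultimately show ?thesis
    by simp
qed

text \<open>The numerals \<open>of_nat n\<close> with \<open>n < p\<close> are \<open>p\<close>
  distinct Frobenius-fixed elements, so by the cardinality hypothesis they exhaust
  \<open>GF p\<close>.\<close>

lemma frobenius_fixed_eq_of_nat:
  fixes t :: "'a::{field,finite}"
  assumes p: "prime p" and char: "CHAR('a) = p" and card: "card (GF p :: 'a set) = p" and t: "t ^ p = t"
  shows "\<exists>n<p. of_nat n = t"
proof -
  have "of_nat n ^ p = (of_nat n :: 'a)" for n
  proof (induction n)
    case 0
    then show ?case
      using p prime_gt_0_nat by (simp add: power_0_left)
  next
    case (Suc n)
    have "(of_nat n + 1 :: 'a) ^ p = of_nat n ^ p + 1 ^ p"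
      using p char by (intro freshmans_dream) auto
    with Suc show ?case
      by (simp add: add.commute)
  qed
  then have sub: "of_nat ` {..<p} \<subseteq> (GF p :: 'a set)"
    by (auto simp: GF_def)
  have "inj_on (of_nat :: nat \<Rightarrow> 'a) {..<p}"
    by (intro inj_onI) (auto simp: of_nat_eq_iff_cong_CHAR char cong_def)
  then have "card (of_nat ` {..<p} :: 'a set) = p"
    by (simp add: card_image)
  with sub card have "of_nat ` {..<p} = (GF p :: 'a set)"
    by (intro card_subset_eq) auto
  moreover have "t \<in> GF p"
    using t by (simp add: GF_def)
  ultimately have "t \<in> of_nat ` {..<p}"
    by (simp only:)
  then show ?thesis
    by auto
qed

section \<open>The field of order \<open>q ^ 2\<close>, its subfield \<open>K\<close> and the
  Frobenius map\<close>

locale quadratic_extension =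
  fixes p f q :: nat and \<omega> :: "'a::{field,finite}"
  assumes prime_p: "prime p" and f_pos: "f > 0" and q_eq: "q = p ^ f"
    and card_UNIV: "CARD('a) = q ^ 2"
    and primitive: "primitive_element \<omega>"
    and odd_q: "odd q"
begin

abbreviation K :: "'a set" where "K \<equiv> GF q"

lemma q_ge_3: "q \<ge> 3"
proof -
  have "q > 1"
    using prime_gt_1_nat[OF prime_p] f_pos unfolding q_eq by (rule one_less_power)
  with odd_q show ?thesis
    by (cases "q = 2") auto
qed

lemma omega_nonzero [simp]: "\<omega> \<noteq> 0"
proof -
  have "\<omega> ^ 1 \<in> UNIV - {0}"
    using primitive unfolding primitive_element_def by blast
  then show ?thesis
    by simp
qed

text \<open>The characteristic is a prime dividing the cardinality, which is a power of
  \<open>p\<close>.\<close>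

lemma char_eq: "CHAR('a) = p"
proof -
  have "prime CHAR('a)"
    by (rule prime_CHAR_semidom) (simp add: finite_imp_CHAR_pos)
  moreover have "CHAR('a) dvd p ^ (f * 2)"
    using CHAR_dvd_CARD[where 'a = 'a] by (simp add: card_UNIV q_eq power_mult)
  ultimately show ?thesis
    using prime_p prime_dvd_power primes_dvd_imp_eq by blast
qed

lemma frobenius_add: "(x + y :: 'a) ^ (p ^ k) = x ^ (p ^ k) + y ^ (p ^ k)"
  by (rule freshmans_dream'[of _ k]) (simp_all add: char_eq prime_p)

lemma power_q_add: "(x + y :: 'a) ^ q = x ^ q + y ^ q"
  unfolding q_eq by (rule frobenius_add)

lemma power_q_minus: "(- x :: 'a) ^ q = - (x ^ q)"
  by (rule power_minus_odd[OF odd_q])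

lemma power_q_diff: "(x - y :: 'a) ^ q = x ^ q - y ^ q"
  using power_q_add[of x "- y"] by (simp add: power_q_minus)

lemma power_q_power_q [simp]: "((x :: 'a) ^ q) ^ q = x"
proof (cases "x = 0")
  case False
  have "x ^ (q ^ 2) = x ^ (q ^ 2 - 1) * x"
    using q_ge_3 by (metis One_nat_def Suc_pred' mult.commute not_numeral_le_zero power_Suc
        zero_less_power gr_zeroI)
  then show ?thesis
    using power_card_minus_one_eq_one[OF False] by (simp add: card_UNIV power2_eq_square power_mult)
qed (use q_ge_3 in simp)

lemma K_iff: "x \<in> K \<longleftrightarrow> x ^ q = x"
  by (simp add: GF_def)

lemma K_closed [simp, intro]:
  "0 \<in> K" "1 \<in> K"
  "x \<in> K \<Longrightarrow> y \<in> K \<Longrightarrow> x + y \<in> K"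
  "x \<in> K \<Longrightarrow> y \<in> K \<Longrightarrow> x - y \<in> K"
  "x \<in> K \<Longrightarrow> y \<in> K \<Longrightarrow> x * y \<in> K"
  "x \<in> K \<Longrightarrow> y \<in> K \<Longrightarrow> x / y \<in> K"
  "x \<in> K \<Longrightarrow> - x \<in> K"
  using q_ge_3
  by (auto simp: K_iff power_q_add power_q_diff power_q_minus power_mult_distrib power_divide
      power_0_left)

lemma trace_in_K [simp]: "x + x ^ q \<in> K"
  by (simp add: K_iff power_q_add add.commute)

section \<open>Exponents of the primitive element and the subfields they describe\<close>

lemma omega_order: "\<omega> ^ (q ^ 2 - 1) = 1"
  using power_card_minus_one_eq_one[OF omega_nonzero] by (simp add: card_UNIV)

lemma order_pos: "q ^ 2 - 1 > 0"
  using q_ge_3 by (simp add: power2_eq_square) (metis One_nat_def Suc_lessI mult_eq_1_iff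
      nat_0_less_mult_iff not_numeral_le_zero numeral_le_one_iff semiring_norm(70) gr_zeroI)

lemma omega_power_mod: "\<omega> ^ k = \<omega> ^ (k mod (q ^ 2 - 1))"
proof -
  have "\<omega> ^ k = \<omega> ^ ((q ^ 2 - 1) * (k div (q ^ 2 - 1)) + k mod (q ^ 2 - 1))"
    by simp
  also have "\<dots> = \<omega> ^ (k mod (q ^ 2 - 1))"
    unfolding power_add power_mult omega_order by simp
  finally show ?thesis .
qed

lemma omega_image: "(\<lambda>k. \<omega> ^ k) ` {..<q ^ 2 - 1} = UNIV - {0}"
proof
  show "UNIV - {0} \<subseteq> (\<lambda>k. \<omega> ^ k) ` {..<q ^ 2 - 1}"
  proof
    fix x :: 'a
    assume "x \<in> UNIV - {0}"
    then obtain k where "x = \<omega> ^ k"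
      using primitive unfolding primitive_element_def by blast
    then have "x = \<omega> ^ (k mod (q ^ 2 - 1))"
      using omega_power_mod by simp
    then show "x \<in> (\<lambda>k. \<omega> ^ k) ` {..<q ^ 2 - 1}"
      using order_pos by (intro image_eqI) auto
  qed
qed auto

text \<open>The \<open>q ^ 2 - 1\<close> exponents are mapped onto \<open>q ^ 2 - 1\<close> nonzero
  elements, so no value is taken twice.\<close>

lemma omega_inj: "inj_on (\<lambda>k. \<omega> ^ k) {..<q ^ 2 - 1}"
  by (rule eq_card_imp_inj_on) (simp_all only: omega_image card_Diff_singleton card_UNIV
      UNIV_I card_lessThan finite_lessThan)

lemma omega_power_eq_iff: "\<omega> ^ j = \<omega> ^ k \<longleftrightarrow> [j = k] (mod (q ^ 2 - 1))"
proof -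
  have "\<omega> ^ (j mod (q ^ 2 - 1)) = \<omega> ^ (k mod (q ^ 2 - 1)) \<longleftrightarrow> j mod (q ^ 2 - 1) = k mod (q ^ 2 - 1)"
    using order_pos by (intro inj_on_eq_iff[OF omega_inj]) auto
  then show ?thesis
    using omega_power_mod[of j] omega_power_mod[of k] by (simp add: cong_def)
qed

lemma omega_power_eq_1_iff: "\<omega> ^ k = 1 \<longleftrightarrow> (q ^ 2 - 1) dvd k"
  using omega_power_eq_iff[of k 0] by (simp add: cong_0_iff)

text \<open>For \<open>x = \<omega> ^ j\<close>, the equation \<open>x ^ (Q - 1) = 1\<close> says
  that \<open>e * (Q - 1)\<close> divides \<open>j * (Q - 1)\<close>, that is,
  \<open>e dvd j\<close>. The lemma serves both \<open>Q = q\<close> and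
  \<open>Q = p\<close>.\<close>

lemma nonzero_GF_eq:
  assumes e: "e * (Q - 1) = q ^ 2 - 1" and "Q \<ge> 2"
  shows "GF Q - {0} = (\<lambda>k. \<omega> ^ (e * k)) ` {..<Q - 1}"
    and "card (GF Q :: 'a set) = Q"
proof -
  have e0: "e > 0"
    using e order_pos by (cases e) auto
  have Q: "Q = Suc (Q - 1)"
    using assms(2) by simp
  have fixed: "x ^ Q = x \<longleftrightarrow> x ^ (Q - 1) = 1" if "x \<noteq> 0" for x :: 'a
    by (subst Q) (use that in simp)
  show eq: "GF Q - {0} = (\<lambda>k. \<omega> ^ (e * k)) ` {..<Q - 1}"
  proof (intro equalityI subsetI)
    fix x :: 'a
    assume x: "x \<in> GF Q - {0}"
    then obtain j where j: "j < q ^ 2 - 1" "x = \<omega> ^ j"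
      using omega_image by (metis (no_types, lifting) DiffD2 DiffI UNIV_I imageE lessThan_iff)
    with x have "\<omega> ^ (j * (Q - 1)) = 1"
      using fixed[of x] by (auto simp: GF_def power_mult)
    then have "e * (Q - 1) dvd j * (Q - 1)"
      by (simp only: omega_power_eq_1_iff e)
    then have "e dvd j"
      using assms(2) by (simp only: dvd_times_right_cancel_iff)
    then obtain k where k: "j = e * k"
      by (rule dvdE)
    with j(1) have "k < Q - 1"
      by (simp only: e[symmetric] mult_less_cancel1)
    with k j(2) show "x \<in> (\<lambda>k. \<omega> ^ (e * k)) ` {..<Q - 1}"
      by auto
  next
    fix x :: 'a
    assume "x \<in> (\<lambda>k. \<omega> ^ (e * k)) ` {..<Q - 1}"
    then obtain k where k: "x = \<omega> ^ (e * k)"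
      by auto
    have "x ^ (Q - 1) = \<omega> ^ ((q ^ 2 - 1) * k)"
      unfolding k power_mult[symmetric] e[symmetric] by (simp add: mult_ac)
    also have "\<dots> = 1"
      by (simp add: omega_power_eq_1_iff)
    finally show "x \<in> GF Q - {0}"
      using fixed[of x] k by (simp add: GF_def)
  qed
  have "inj_on (\<lambda>k. \<omega> ^ (e * k)) {..<Q - 1}"
  proof (rule inj_onI)
    fix j k
    assume "j \<in> {..<Q - 1}" "k \<in> {..<Q - 1}" "\<omega> ^ (e * j) = \<omega> ^ (e * k)"
    moreover from this have "e * j \<in> {..<q ^ 2 - 1}" "e * k \<in> {..<q ^ 2 - 1}"
      using e0 by (simp_all only: lessThan_iff e[symmetric] mult_less_cancel1)
    ultimately have "e * j = e * k"
      using omega_inj by (auto dest: inj_onD)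
    with e0 show "j = k"
      by simp
  qed
  then have "card (GF Q - {0} :: 'a set) = Q - 1"
    unfolding eq by (simp add: card_image)
  moreover have "(0 :: 'a) \<in> GF Q"
    using assms(2) by (simp add: GF_def)
  ultimately show "card (GF Q :: 'a set) = Q"
    using Q card_Suc_Diff1[of "GF Q :: 'a set" 0] by simp
qed

lemma q_plus_1_mult: "(q + 1) * (q - 1) = q ^ 2 - 1"
  by (simp add: power2_eq_square algebra_simps)

lemma nonzero_K_eq: "K - {0} = (\<lambda>k. \<omega> ^ ((q + 1) * k)) ` {..<q - 1}"
  using nonzero_GF_eq(1)[OF q_plus_1_mult] q_ge_3 by simp

lemma card_K: "card K = q"
  using nonzero_GF_eq(2)[OF q_plus_1_mult] q_ge_3 by simp

section \<open>The prime field, traces and the canonical additive character\<close>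

lemma card_prime_field: "card (GF p :: 'a set) = p"
proof -
  \<comment> \<open>Since \<open>p\<close> is 1 modulo \<open>p - 1\<close>, so is its power
    \<open>q ^ 2\<close>.\<close>
  have "[p ^ (f * 2) = 1 ^ (f * 2)] (mod p - 1)"
    using prime_ge_1_nat[OF prime_p] by (intro cong_pow) (simp add: cong_altdef_nat)
  then have "p - 1 dvd q ^ 2 - 1"
    using prime_ge_1_nat[OF prime_p] by (simp add: q_eq cong_altdef_nat flip: power_mult)
  then obtain e where "q ^ 2 - 1 = e * (p - 1)"
    by (metis dvdE mult.commute)
  then show ?thesis
    using nonzero_GF_eq(2)[of e p] prime_ge_2_nat[OF prime_p] by simp
qed

text \<open>The description \<open>THE n\<close> in the definition of the additive character is not junk.\<close>

lemma trace_in_prime_field: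
  assumes "x \<in> K"
  shows "\<exists>!n. n < p \<and> of_nat n = abs_trace p f x"
proof -
  have "abs_trace p f x ^ p = (\<Sum>i<f. (x ^ (p ^ i)) ^ p)"
    unfolding abs_trace_def by (rule freshmans_dream_sum) (simp_all add: char_eq prime_p)
  also have "\<dots> = (\<Sum>i<f. x ^ (p ^ Suc i))"
    by (simp add: power_mult mult.commute flip: power_mult)
  \<comment> \<open>Frobenius shifts the indices of the trace by one. Adding \<open>x\<close>
    restores index 0, and the top term \<open>x ^ (p ^ f)\<close> is \<open>x\<close> again because
    \<open>x\<close> lies in \<open>K\<close>.\<close>
  also have "\<dots> + x = (\<Sum>i<Suc f. x ^ (p ^ i))"
    by (subst sum.lessThan_Suc_shift) simp
  also have "\<dots> = abs_trace p f x + x"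
    using assms by (simp add: abs_trace_def GF_def q_eq)
  finally have "\<exists>n<p. of_nat n = abs_trace p f x"
    by (intro frobenius_fixed_eq_of_nat[OF prime_p char_eq card_prime_field]) simp
  then show ?thesis
    by (metis char_eq cong_less_modulus_unique_nat of_nat_eq_iff_cong_CHAR)
qed

text \<open>By periodicity of \<open>exp\<close>, any natural number representing the trace may be
  used, reduced modulo \<open>p\<close> or not. Additivity follows, since a sum of two
  representatives need not be below \<open>p\<close>.\<close>

lemma add_char_eqI:
  assumes "x \<in> K" "of_nat n = abs_trace p f x"
  shows "add_char p f x = exp (2 * of_real pi * \<i> * of_nat n / of_nat p)"
proof -
  have p: "p > 0"
    using prime_p prime_gt_0_nat by blast
  have "of_nat (n mod p) = (of_nat n :: 'a)"
    by (simp add: of_nat_eq_iff_cong_CHAR char_eq)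
  with p assms have "(THE n. n < p \<and> of_nat n = abs_trace p f x) = n mod p"
    by (intro the1_equality trace_in_prime_field) auto
  then have "add_char p f x = exp (2 * of_real pi * \<i> * of_nat (n mod p) / of_nat p)"
    by (simp add: add_char_def)
  also have "\<dots> = exp (2 * of_real pi * \<i> * of_nat (n mod p) / of_nat p
                      + of_nat (n div p) * (2 * of_real pi * \<i>))"
    by (simp add: exp_add exp_of_nat_mult)
  also have "2 * of_real pi * \<i> * of_nat (n mod p) / of_nat p + of_nat (n div p) * (2 * of_real pi * \<i>)
      = 2 * of_real pi * \<i> * of_nat (p * (n div p) + n mod p) / of_nat p"
    unfolding of_nat_add of_nat_mult using p by (simp add: field_simps)
  finally show ?thesis
    by simp
qed

lemma add_char_add:
  assumes "x \<in> K" "y \<in> K"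
  shows "add_char p f (x + y) = add_char p f x * add_char p f y"
proof -
  obtain m n where mn: "of_nat m = abs_trace p f x" "of_nat n = abs_trace p f y"
    using trace_in_prime_field assms by metis
  then have "of_nat (m + n) = abs_trace p f (x + y)"
    by (simp add: abs_trace_def frobenius_add sum.distrib)
  then show ?thesis
    using assms mn
    by (simp add: add_char_eqI[of _ "m + n"] add_char_eqI[of _ m] add_char_eqI[of _ n]
        add_divide_distrib distrib_left flip: exp_add)
qed

lemma add_char_0 [simp]: "add_char p f (0 :: 'a) = 1"
proof -
  have "abs_trace p f (0 :: 'a) = 0"
    using prime_p prime_gt_0_nat by (auto simp: abs_trace_def power_0_left)
  then show ?thesis
    using add_char_eqI[of 0 0] by simp
qed

text \<open>Transitivity of the trace: the indices from \<open>f\<close> on contribute the trace of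
  \<open>x ^ q\<close>.\<close>

lemma add_char_extension: "add_char p (2 * f) x = add_char p f (x + x ^ q)" for x :: 'a
proof -
  have "abs_trace p (2 * f) x = (\<Sum>i<f. x ^ (p ^ i)) + (\<Sum>i<f. x ^ (p ^ (f + i)))"
    unfolding abs_trace_def using sum.nat_group[of "\<lambda>i. x ^ (p ^ i)" f 2]
    by (simp add: numeral_2_eq_2 lessThan_Suc sum.atLeastLessThan_shift_0[of _ f] atLeast0LessThan
        add.commute)
  then have "abs_trace p (2 * f) x = abs_trace p f (x + x ^ q)"
    by (simp add: abs_trace_def frobenius_add sum.distrib q_eq power_add power_mult)
  then show ?thesis
    by (simp add: add_char_def)
qed

section \<open>The quadratic character, integer-valued so that line sums stay integers\<close>

definition chi :: "'a \<Rightarrow> int" where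
  "chi x = (if x = 0 then 0 else if x \<in> nonzero_squares K then 1 else - 1)"

lemma quadratic_char_eq: "quadratic_char K x = of_int (chi x)"
  by (simp add: quadratic_char_def chi_def)

lemma chi_0 [simp]: "chi 0 = 0"
  by (simp add: chi_def)

lemma nonzero_squares_eq: "nonzero_squares K = {\<omega> ^ (2 * (q + 1) * k) | k. True}"
proof -
  have "nonzero_squares K = (\<lambda>y. y ^ 2) ` (K - {0})"
    by (auto simp: nonzero_squares_def)
  \<comment> \<open>The exponents are left unbounded so that squares are recognised without
    reduction modulo \<open>q - 1\<close>.\<close>
  also have "K - {0} = range (\<lambda>k. \<omega> ^ ((q + 1) * k))"
  proof -
    have "\<omega> ^ ((q + 1) * k) \<in> K - {0}" for k
    proof -
      have "(\<omega> ^ ((q + 1) * k)) ^ q = (\<omega> ^ q) ^ (q * k) * (\<omega> ^ q) ^ k"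
        by (simp add: algebra_simps flip: power_mult power_add)
      also have "\<dots> = \<omega> ^ k * \<omega> ^ (q * k)"
        by (simp add: power_mult)
      finally show ?thesis
        by (simp add: K_iff algebra_simps power_add)
    qed
    then show ?thesis
      using nonzero_K_eq by auto
  qed
  also have "(\<lambda>y. y ^ 2) ` \<dots> = {\<omega> ^ (2 * (q + 1) * k) | k. True}"
    unfolding image_image power_mult[symmetric] by (auto simp: mult_ac)
  finally show ?thesis .
qed

text \<open>The exponent of the generator \<open>\<omega> ^ (q + 1)\<close> is determined modulo
  \<open>q - 1\<close>, which is even, so its parity is well defined.\<close>

lemma omega_power_mem_nonzero_squares_iff:
  "\<omega> ^ ((q + 1) * k) \<in> nonzero_squares K \<longleftrightarrow> even k"
proof
  assume "\<omega> ^ ((q + 1) * k) \<in> nonzero_squares K"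
  then obtain j where "[(q + 1) * k = (q + 1) * (2 * j)] (mod (q + 1) * (q - 1))"
    unfolding nonzero_squares_eq q_plus_1_mult by (auto simp: omega_power_eq_iff mult_ac)
  then have "[k = 2 * j] (mod q - 1)"
    by (simp add: cong_def mult_mod_right[symmetric] del: mult_Suc)
  then have "[k = 2 * j] (mod 2)"
    by (rule cong_dvd_modulus_nat) (use odd_q in simp)
  then show "even k"
    by (simp add: cong_def even_iff_mod_2_eq_zero)
next
  assume "even k"
  then show "\<omega> ^ ((q + 1) * k) \<in> nonzero_squares K"
    by (auto simp: nonzero_squares_eq mult_ac elim!: evenE)
qed

lemma chi_omega_power: "chi (\<omega> ^ ((q + 1) * k)) = (- 1) ^ k"
  using omega_power_mem_nonzero_squares_iff[of k] by (auto simp: chi_def)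

lemma chi_mult:
  assumes "x \<in> K" "y \<in> K"
  shows "chi (x * y) = chi x * chi y"
proof (cases "x = 0 \<or> y = 0")
  case False
  with assms obtain j k where "x = \<omega> ^ ((q + 1) * j)" "y = \<omega> ^ ((q + 1) * k)"
    using nonzero_K_eq by (metis (no_types, lifting) DiffI imageE singletonD)
  moreover from this have "x * y = \<omega> ^ ((q + 1) * (j + k))"
    by (simp only: distrib_left power_add)
  ultimately show ?thesis
    by (simp only: chi_omega_power power_add)
qed auto

lemma chi_mult_self: "x \<noteq> 0 \<Longrightarrow> chi x * chi x = 1"
  by (simp add: chi_def)

lemma chi_cases: "x \<noteq> 0 \<Longrightarrow> chi x = 1 \<or> chi x = - 1"
  by (simp add: chi_def)

lemma chi_inverse: "x \<in> K \<Longrightarrow> chi (1 / x) = chi x"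
  by (cases "x = 0") (use chi_mult[of "1 / x" "x * x"] chi_mult[of x x] chi_mult_self[of x] in auto)

text \<open>If \<open>- 1\<close> is the \<open>k\<close>-th power of
  \<open>\<omega> ^ (q + 1)\<close>, then \<open>q - 1\<close> divides \<open>2 * k\<close>, and
  divisibility of \<open>q - 1\<close> by 4 makes \<open>k\<close> even.\<close>

lemma chi_minus_one:
  assumes "4 dvd q - 1"
  shows "chi (- 1) = 1"
proof -
  have "- 1 \<in> K - {0}"
    by simp
  then obtain k where k: "- 1 = \<omega> ^ ((q + 1) * k)"
    unfolding nonzero_K_eq by blast
  then have "\<omega> ^ ((q + 1) * k + (q + 1) * k) = 1"
    by (simp only: power_add flip: k) simp
  moreover have "(q + 1) * k + (q + 1) * k = (q + 1) * (2 * k)"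
    by simp
  ultimately have "\<omega> ^ ((q + 1) * (2 * k)) = 1"
    by (simp only:)
  then have "(q + 1) * (q - 1) dvd (q + 1) * (2 * k)"
    by (simp only: omega_power_eq_1_iff q_plus_1_mult)
  then have "q - 1 dvd 2 * k"
    by (subst (asm) nat_mult_dvd_cancel1) simp_all
  with assms have "4 dvd 2 * k"
    by (rule dvd_trans)
  then have "even k"
    by presburger
  then show ?thesis
    using k chi_omega_power[of k] by simp
qed

lemma mem_nonzero_squares_iff: "c \<in> nonzero_squares K \<longleftrightarrow> c \<in> K \<and> chi c = 1"
  by (auto simp: chi_def nonzero_squares_def power2_eq_square)

section \<open>Integer exponents and cyclotomic classes\<close>

lemma omega_powi_eq_1_iff: "\<omega> powi j = 1 \<longleftrightarrow> int (q ^ 2 - 1) dvd j"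
proof (cases j rule: int_cases2)
  case (nonneg n)
  then show ?thesis
    by (simp only: power_int_of_nat omega_power_eq_1_iff of_nat_dvd_iff)
next
  case (nonpos n)
  then show ?thesis
    by (simp only: power_int_minus power_int_of_nat inverse_eq_1_iff omega_power_eq_1_iff of_nat_dvd_iff
        dvd_minus_iff)
qed

text \<open>Being fixed by the \<open>q\<close>-th power means that \<open>(q - 1) * (q + 1)\<close>
  divides \<open>(q - 1) * j\<close>. This translates the condition on \<open>l\<close> into
  \<open>L \<notin> K\<close>.\<close>

lemma omega_powi_in_K_iff: "\<omega> powi j \<in> K \<longleftrightarrow> int (q + 1) dvd j"
proof -
  have "\<omega> powi j \<in> K \<longleftrightarrow> \<omega> powi (j * int q - j) = 1"
    by (simp add: K_iff power_int_power' power_int_diff)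
  also have "j * int q - j = int (q - 1) * j"
    using q_ge_3 by (simp add: of_nat_diff algebra_simps)
  also have "\<omega> powi \<dots> = 1 \<longleftrightarrow> int (q - 1) * int (q + 1) dvd int (q - 1) * j"
    unfolding omega_powi_eq_1_iff q_plus_1_mult[symmetric] of_nat_mult by (simp only: mult.commute)
  also have "\<dots> \<longleftrightarrow> int (q + 1) dvd j"
    using q_ge_3 by (intro dvd_times_left_cancel_iff) auto
  finally show ?thesis .
qed

text \<open>The order \<open>4 * m ^ 2\<close> of the classes equals \<open>2 * (q + 1)\<close>, and
  \<open>\<omega> ^ (2 * (q + 1))\<close> generates the group of nonzero squares of
  \<open>K\<close>.\<close>

lemma cyclotomic_class_eq:
  assumes "e = 2 * (int q + 1)"
  shows "cyclotomic_class \<omega> e i = (\<lambda>c. \<omega> powi i * c) ` nonzero_squares K"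
proof -
  have "{(\<omega> powi e) powi k | k. True} = nonzero_squares K"
  proof (intro equalityI subsetI)
    fix c
    assume "c \<in> {(\<omega> powi e) powi k | k. True}"
    then obtain k where "c = (\<omega> powi e) powi k"
      by blast
    then have "c = (\<omega> powi ((int q + 1) * k)) ^ 2"
      unfolding assms by (simp add: power_int_power' mult_ac flip: power_int_mult)
    moreover have "\<omega> powi ((int q + 1) * k) \<in> K"
      unfolding omega_powi_in_K_iff of_nat_add of_nat_1 by (rule dvd_triv_left)
    moreover have "\<omega> powi ((int q + 1) * k) \<noteq> 0"
      by simp
    ultimately show "c \<in> nonzero_squares K"
      unfolding nonzero_squares_def by blast
  next
    fix c
    assume "c \<in> nonzero_squares K"
    then obtain k where "c = \<omega> ^ (2 * (q + 1) * k)"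
      unfolding nonzero_squares_eq by blast
    then have "c = \<omega> powi (int (2 * (q + 1) * k))"
      by (simp only: power_int_of_nat)
    also have "\<dots> = (\<omega> powi e) powi (int k)"
      unfolding power_int_mult[symmetric] assms by (simp add: algebra_simps)
    finally show "c \<in> {(\<omega> powi e) powi k | k. True}"
      by blast
  qed
  then show ?thesis
    unfolding cyclotomic_class_def by (auto simp: set_eq_iff image_iff)
qed

lemma nonsquare_in_K: "\<omega> ^ (q + 1) \<in> K" "\<omega> ^ (q + 1) \<noteq> 0" "chi (\<omega> ^ (q + 1)) = - 1"
  using chi_omega_power[of 1] by (simp_all add: K_iff power_add power_mult_distrib mult.commute)

text \<open>Squares of \<open>K\<close> preserve \<open>A\<close> and \<open>B\<close>. The
  nonsquare \<open>\<omega> ^ (q + 1)\<close> carries \<open>B\<close> onto \<open>A\<close>, and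
  since its own square preserves \<open>B\<close>, every nonsquare of \<open>K\<close> interchanges
  the two sets.\<close>

lemma signed_indicator_scale:
  assumes A: "\<And>c x. c \<in> nonzero_squares K \<Longrightarrow> x \<in> A \<Longrightarrow> c * x \<in> A"
    and B: "\<And>c x. c \<in> nonzero_squares K \<Longrightarrow> x \<in> B \<Longrightarrow> c * x \<in> B"
    and AB: "A = (\<lambda>x. \<omega> ^ (q + 1) * x) ` B" and c: "c \<in> K" and zero: "0 \<notin> A" "0 \<notin> B"
  shows "of_bool (c * z \<in> A) - of_bool (c * z \<in> B)
       = chi c * (of_bool (z \<in> A) - of_bool (z \<in> B) :: int)"
proof (cases "c = 0")
  case False
  define n where "n = \<omega> ^ (q + 1)"
  have n: "n \<in> K" "n \<noteq> 0" "chi n = - 1" and AB: "A = (\<lambda>x. n * x) ` B"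
    using nonsquare_in_K AB by (simp_all only: n_def simp_thms)
  have step: "c * z \<in> (if chi c = 1 then A else B)" if c: "c \<in> K" "c \<noteq> 0" and z: "z \<in> A" for c z
  proof (cases "chi c = 1")
    case True
    with A c z show ?thesis
      by (simp add: mem_nonzero_squares_iff)
  next
    case False
    then have "chi (c * n) = 1"
      using chi_mult[OF c(1) n(1)] chi_cases[OF c(2)] n(3) by simp
    moreover obtain y where "y \<in> B" "z = n * y"
      using z AB by blast
    ultimately show ?thesis
      using False B[of "c * n" y] c(1) n(1) by (simp add: mem_nonzero_squares_iff mult_ac)
  qed
  have step': "c * z \<in> (if chi c = 1 then B else A)" if c: "c \<in> K" "c \<noteq> 0" and z: "z \<in> B" for c z
  proof (cases "chi c = 1")
    case True
    with B c z show ?thesis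
      by (simp add: mem_nonzero_squares_iff)
  next
    case False
    \<comment> \<open>A nonsquare \<open>c\<close> is \<open>n\<close> times the square
      \<open>c / n\<close>; the square keeps \<open>z\<close> in \<open>B\<close> and
      \<open>n\<close> then moves it to \<open>A\<close>.\<close>
    have cn: "c / n \<in> K"
      using c(1) n(1) by simp
    moreover have "chi (c / n) = 1"
      using chi_mult[OF cn n(1)] chi_cases[OF c(2)] n False by auto
    ultimately have "c / n * z \<in> B"
      using B z by (simp only: mem_nonzero_squares_iff)
    moreover have "c * z = n * (c / n * z)"
      using n(2) by simp
    ultimately show ?thesis
      using False AB by (metis (no_types, lifting) imageI)
  qed
  \<comment> \<open>Applying both inclusions to \<open>1 / c\<close> as well turns them into
    equivalences.\<close>
  have inv: "1 / c \<in> K" "1 / c \<noteq> 0" "chi (1 / c) = chi c" "1 / c * (c * z) = z"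
    using c False by (auto simp: chi_inverse)
  show ?thesis
  proof (cases "chi c = 1")
    case True
    then have "c * z \<in> A \<longleftrightarrow> z \<in> A" "c * z \<in> B \<longleftrightarrow> z \<in> B"
      using step[OF c False, of z] step[OF inv(1,2), of "c * z"]
        step'[OF c False, of z] step'[OF inv(1,2), of "c * z"] inv(3,4) by auto
    with True show ?thesis
      by simp
  next
    case nonsquare: False
    then have "c * z \<in> A \<longleftrightarrow> z \<in> B" "c * z \<in> B \<longleftrightarrow> z \<in> A"
      using step[OF c False, of z] step[OF inv(1,2), of "c * z"]
        step'[OF c False, of z] step'[OF inv(1,2), of "c * z"] inv(3,4) by auto
    moreover have "chi c = - 1"
      using nonsquare chi_cases[OF False] by blast
    ultimately show ?thesis
      by simp
  qed
qed (use zero in simp)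

section \<open>Character sums over \<open>K\<close> and the Gauss sum\<close>

lemma sum_K_mult:
  assumes "c \<in> K" "c \<noteq> 0"
  shows "(\<Sum>x\<in>K. F (c * x)) = (\<Sum>x\<in>K. F x)"
  by (rule sum.reindex_bij_witness[of _ "\<lambda>y. y / c" "\<lambda>y. c * y"]) (use assms in auto)

lemma sum_K_diff:
  assumes "c \<in> K"
  shows "(\<Sum>x\<in>K. F (x - c)) = (\<Sum>x\<in>K. F x)"
  by (rule sum.reindex_bij_witness[of _ "\<lambda>y. y + c" "\<lambda>y. y - c"]) (use assms in auto)

text \<open>Scaling the summation variable by a nonsquare changes the sign of the sum.\<close>

lemma sum_chi: "(\<Sum>x\<in>K. chi x) = 0"
proof -
  have "(\<Sum>x\<in>K. chi x) = (\<Sum>x\<in>K. chi (\<omega> ^ (q + 1) * x))"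
    using nonsquare_in_K by (intro sum_K_mult[symmetric])
  also have "\<dots> = - (\<Sum>x\<in>K. chi x)"
    using nonsquare_in_K by (simp add: chi_mult sum_negf del: power_Suc power_add Suc_eq_plus1 add_Suc_right)
  finally show ?thesis
    by simp
qed

lemma gauss_sum_eq: "gauss_sum p f (quadratic_char K) = (\<Sum>x\<in>K. of_int (chi x) * add_char p f x)"
  unfolding gauss_sum_def q_eq[symmetric]
  by (rule sum.mono_neutral_cong_left) (auto simp: quadratic_char_eq)

text \<open>Translation by \<open>a\<close> leaves the sum unchanged but also changes it by the
  factor \<open>add_char p f a\<close>, so the sum vanishes.\<close>

lemma sum_add_char:
  assumes a: "a \<in> K" "add_char p f a \<noteq> 1" and c: "c \<in> K" "c \<noteq> 0"
  shows "(\<Sum>x\<in>K. add_char p f (x * c)) = 0"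
proof -
  have "(\<Sum>x\<in>K. add_char p f (x * c)) = (\<Sum>x\<in>K. add_char p f x)"
    using sum_K_mult[OF c] by (simp add: mult.commute)
  moreover have "(\<Sum>x\<in>K. add_char p f x) = (\<Sum>x\<in>K. add_char p f (x - a))"
    by (rule sum_K_diff[OF a(1), symmetric])
  moreover have "(\<Sum>x\<in>K. add_char p f (x - a)) * add_char p f a = (\<Sum>x\<in>K. add_char p f x)"
    using a(1) by (simp add: sum_distrib_right flip: add_char_add)
  ultimately show ?thesis
    using a(2) by simp
qed

text \<open>The classical evaluation of the square of the quadratic Gauss sum as
  \<open>chi (- 1) * q\<close>: substitute \<open>y = x * t\<close> in the double sum and sum over
  \<open>x\<close> first.\<close>

lemma gauss_sum_nonzero:
  assumes a: "a \<in> K" "add_char p f a \<noteq> 1"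
  shows "gauss_sum p f (quadratic_char K) \<noteq> 0"
proof -
  let ?\<psi> = "add_char p f" and ?\<chi> = "\<lambda>x. of_int (chi x) :: complex"
  define g where "g = (\<Sum>x\<in>K. ?\<chi> x * ?\<psi> x)"
  have inner: "(\<Sum>y\<in>K. ?\<chi> x * ?\<psi> x * (?\<chi> y * ?\<psi> y))
      = (\<Sum>t\<in>K. ?\<chi> t * (if x = 0 then 0 else ?\<psi> (x * (1 + t))))" if x: "x \<in> K" for x
  proof (cases "x = 0")
    case False
    have "(\<Sum>y\<in>K. ?\<chi> x * ?\<psi> x * (?\<chi> y * ?\<psi> y))
        = (\<Sum>t\<in>K. ?\<chi> x * ?\<psi> x * (?\<chi> (x * t) * ?\<psi> (x * t)))"
      by (rule sum_K_mult[symmetric]) fact+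
    also have "\<dots> = (\<Sum>t\<in>K. ?\<chi> t * ?\<psi> (x * (1 + t)))"
    proof (rule sum.cong[OF refl])
      fix t
      assume t: "t \<in> K"
      have "?\<chi> x * ?\<chi> x = 1"
        using chi_mult_self[OF False] by (metis of_int_1 of_int_mult)
      then have "?\<chi> x * ?\<chi> (x * t) = ?\<chi> t"
        using t x by (simp add: chi_mult flip: mult.assoc)
      moreover have "?\<psi> (x * (1 + t)) = ?\<psi> x * ?\<psi> (x * t)"
        using t x by (simp add: distrib_left add_char_add)
      ultimately show "?\<chi> x * ?\<psi> x * (?\<chi> (x * t) * ?\<psi> (x * t)) = ?\<chi> t * ?\<psi> (x * (1 + t))"
        by (metis (no_types, lifting) mult.assoc mult.left_commute)
    qed
    finally show ?thesis
      using False by simp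
  qed simp
  have "g * g = (\<Sum>x\<in>K. \<Sum>y\<in>K. ?\<chi> x * ?\<psi> x * (?\<chi> y * ?\<psi> y))"
    unfolding g_def by (rule sum_product)
  also have "\<dots> = (\<Sum>x\<in>K. \<Sum>t\<in>K. ?\<chi> t * (if x = 0 then 0 else ?\<psi> (x * (1 + t))))"
    by (rule sum.cong[OF refl inner])
  also have "\<dots> = (\<Sum>t\<in>K. \<Sum>x\<in>K. ?\<chi> t * (if x = 0 then 0 else ?\<psi> (x * (1 + t))))"
    by (rule sum.swap)
  \<comment> \<open>The sum over nonzero \<open>x\<close> is \<open>q - 1\<close> for
    \<open>t = - 1\<close> and \<open>- 1\<close> otherwise, by orthogonality.\<close>
  also have "\<dots> = (\<Sum>t\<in>K. if t = - 1 then ?\<chi> t * of_nat q - ?\<chi> t else - ?\<chi> t)"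
  proof (rule sum.cong[OF refl])
    fix t
    assume t: "t \<in> K"
    have "(\<Sum>x\<in>K. if x = 0 then 0 else ?\<psi> (x * (1 + t)))
        = (\<Sum>x\<in>K. ?\<psi> (x * (1 + t)) - (if x = 0 then 1 else 0))"
      by (intro sum.cong) auto
    also have "\<dots> = (\<Sum>x\<in>K. ?\<psi> (x * (1 + t))) - 1"
      by (simp add: sum_subtractf)
    also have "(\<Sum>x\<in>K. ?\<psi> (x * (1 + t))) = (if t = - 1 then of_nat q else 0)"
    proof (cases "t = - 1")
      case False
      then have "1 + t \<noteq> 0"
        by (metis add.commute add_eq_0_iff2)
      with False show ?thesis
        using sum_add_char[OF a, of "1 + t"] t by simp
    qed (simp add: card_K)
    finally show "(\<Sum>x\<in>K. ?\<chi> t * (if x = 0 then 0 else ?\<psi> (x * (1 + t))))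
        = (if t = - 1 then ?\<chi> t * of_nat q - ?\<chi> t else - ?\<chi> t)"
      by (simp add: right_diff_distrib flip: sum_distrib_left)
  qed
  also have "\<dots> = (\<Sum>t\<in>K. (if t = - 1 then ?\<chi> t * of_nat q else 0) - ?\<chi> t)"
    by (intro sum.cong) auto
  also have "\<dots> = ?\<chi> (- 1) * of_nat q"
    using sum_chi by (simp add: sum_subtractf sum_negf flip: of_int_sum)
  also have "\<dots> \<noteq> 0"
    using q_ge_3 by (simp add: chi_def)
  finally show ?thesis
    unfolding gauss_sum_eq g_def by auto
qed

section \<open>Sums over affine lines: Fourier coefficients and quadratic twists\<close>

lemma line_sum_eq_fourier:
  fixes h :: "'a \<Rightarrow> int"
  assumes h: "\<And>c z. c \<in> K \<Longrightarrow> h (c * z) = chi c * h z"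
    and v: "b * v + (b * v) ^ q = 0" "v \<noteq> 0" and u: "b * u + (b * u) ^ q = 1"
  shows "(\<Sum>z\<in>UNIV. of_int (h z) * add_char p (2 * f) (b * z))
       = gauss_sum p f (quadratic_char K) * of_int (\<Sum>y\<in>K. h (u + y * v))"
proof -
  define T where "T z = b * z + (b * z) ^ q" for z
  \<comment> \<open>\<open>T\<close> is \<open>K\<close>-linear, kills \<open>v\<close> and takes
    the value 1 at \<open>u\<close>, so it reads off the coordinate \<open>t\<close>.\<close>
  have T_lin: "T (t * u + y * v) = t" if "t \<in> K" "y \<in> K" for t y
  proof -
    have "T (t * u + y * v) = t * (b * u + (b * u) ^ q) + y * (b * v + (b * v) ^ q)"
      using that by (simp add: T_def K_iff power_q_add power_mult_distrib algebra_simps)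
    then show ?thesis
      by (simp add: u v)
  qed
  have inj: "inj_on (\<lambda>(t, y). t * u + y * v) (K \<times> K)"
  proof (rule inj_onI, clarify)
    fix t y t' y'
    assume *: "t \<in> K" "y \<in> K" "t' \<in> K" "y' \<in> K" "t * u + y * v = t' * u + y' * v"
    then have "t = t'"
      using T_lin by metis
    with * v(2) show "t = t' \<and> y = y'"
      by simp
  qed
  \<comment> \<open>Injectivity suffices, because \<open>K \<times> K\<close> and the whole field
    both have \<open>q ^ 2\<close> elements.\<close>
  have img: "(\<lambda>(t, y). t * u + y * v) ` (K \<times> K) = UNIV"
    by (rule card_subset_eq)
      (simp_all add: card_image[OF inj] card_cartesian_product card_K card_UNIV power2_eq_square)
  \<comment> \<open>For \<open>t = 0\<close> the line is \<open>K v\<close> and the sum of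
    \<open>chi\<close> makes both sides 0; for other \<open>t\<close>, replacing \<open>y\<close> by
    \<open>t * y\<close> lets \<open>t\<close> be pulled out of \<open>h\<close>.\<close>
  have line: "(\<Sum>y\<in>K. h (t * u + y * v)) = chi t * (\<Sum>y\<in>K. h (u + y * v))" if t: "t \<in> K" for t
  proof (cases "t = 0")
    case True
    then show ?thesis
      by (simp add: h sum_chi flip: sum_distrib_right)
  next
    case False
    have "(\<Sum>y\<in>K. h (t * u + y * v)) = (\<Sum>y\<in>K. h (t * u + (t * y) * v))"
      by (rule sum_K_mult[symmetric]) fact+
    also have "\<dots> = (\<Sum>y\<in>K. h (t * (u + y * v)))"
      by (simp add: algebra_simps)
    finally show ?thesis
      using t by (simp add: h sum_distrib_left)
  qed
  have "(\<Sum>z\<in>UNIV. of_int (h z) * add_char p (2 * f) (b * z))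
      = (\<Sum>z\<in>(\<lambda>(t, y). t * u + y * v) ` (K \<times> K). of_int (h z) * add_char p f (T z))"
    unfolding img by (simp add: add_char_extension T_def)
  also have "\<dots> = (\<Sum>(t, y)\<in>K \<times> K. of_int (h (t * u + y * v)) * add_char p f t)"
    by (subst sum.reindex[OF inj]) (auto intro!: sum.cong simp: T_lin)
  also have "\<dots> = (\<Sum>t\<in>K. \<Sum>y\<in>K. of_int (h (t * u + y * v)) * add_char p f t)"
    by (rule sum.cartesian_product[symmetric])
  also have "\<dots> = (\<Sum>t\<in>K. of_int (\<Sum>y\<in>K. h (t * u + y * v)) * add_char p f t)"
    by (simp add: sum_distrib_right)
  also have "\<dots> = (\<Sum>t\<in>K. of_int (chi t) * add_char p f t * of_int (\<Sum>y\<in>K. h (u + y * v)))"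
    by (intro sum.cong) (simp_all only: line of_int_mult mult_ac)
  also have "\<dots> = gauss_sum p f (quadratic_char K) * of_int (\<Sum>y\<in>K. h (u + y * v))"
    by (simp only: gauss_sum_eq sum_distrib_right)
  finally show ?thesis .
qed

text \<open>With \<open>y = 1 / (x - s)\<close>, \<open>chi (x - s) = chi y\<close> is absorbed into
  \<open>h\<close>, because \<open>y * (1 + x * L) = L + y * (1 + s * L)\<close>. No
  \<open>x\<close> yields \<open>y = 0\<close>, hence the correction \<open>h L\<close>.\<close>

lemma sum_line_chi:
  fixes h :: "'a \<Rightarrow> int"
  assumes h: "\<And>c z. c \<in> K \<Longrightarrow> h (c * z) = chi c * h z" and s: "s \<in> K"
  shows "(\<Sum>x\<in>K. h (1 + x * L) * chi (x - s)) = (\<Sum>y\<in>K. h (L + y * (1 + s * L))) - h L"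
proof -
  have "(\<Sum>x\<in>K. h (1 + x * L) * chi (x - s)) = (\<Sum>x\<in>K - {s}. h (1 + x * L) * chi (x - s))"
    by (rule sum.mono_neutral_right) auto
  also have "\<dots> = (\<Sum>y\<in>K - {0}. h (L + y * (1 + s * L)))"
  proof (rule sum.reindex_bij_witness[of _ "\<lambda>y. s + 1 / y" "\<lambda>x. 1 / (x - s)"])
    fix x
    assume x: "x \<in> K - {s}"
    define y where "y = 1 / (x - s)"
    have y: "y \<in> K" "y \<noteq> 0"
      using x s by (auto simp: y_def)
    have x_eq: "x = s + 1 / y"
      using x by (simp add: y_def)
    have "chi y = chi (x - s)"
      using x s by (simp add: y_def chi_inverse)
    moreover have "y * (1 + x * L) = L + y * (1 + s * L)"
      using y by (simp add: x_eq field_simps)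
    ultimately show "h (L + 1 / (x - s) * (1 + s * L)) = h (1 + x * L) * chi (x - s)"
      using h[OF y(1), of "1 + x * L"] by (simp add: mult.commute flip: y_def)
  qed (use s in auto)
  also have "\<dots> = (\<Sum>y\<in>K. h (L + y * (1 + s * L))) - h L"
    by (simp add: sum_diff1)
  finally show ?thesis .
qed

section \<open>Counting intersections with translates of the squares\<close>

lemma card_inter_translate:
  assumes "A \<subseteq> K" "B \<subseteq> K" "s \<in> K"
  shows "int (card (A \<inter> translate B s)) = (\<Sum>x\<in>K. of_bool (x \<in> A) * of_bool (x - s \<in> B))"
proof -
  have "A \<inter> translate B s = {x \<in> K. x \<in> A \<and> x - s \<in> B}"
  proof -
    have "x \<in> translate B s \<longleftrightarrow> x - s \<in> B" for x
      unfolding translate_def by (metis (no_types, lifting) add_diff_cancel diff_add_cancel image_iff)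
    with assms show ?thesis
      by auto
  qed
  then show ?thesis
    by (simp add: Int_def flip: of_bool_conj)
qed

lemma nonzero_squares_subset: "nonzero_squares K \<subseteq> K - {0}"
  by (auto simp: nonzero_squares_def power2_eq_square)

text \<open>Indicators are doubled to avoid division; the term at 0 compensates for
  \<open>chi 0 = 0\<close>.\<close>

lemma of_bool_squares:
  assumes "x \<in> K"
  shows "2 * of_bool (x \<in> nonzero_squares K \<union> {0}) = 1 + chi x + of_bool (x = 0)"
    and "2 * of_bool (x \<in> nonzero_squares K) = 1 + chi x - of_bool (x = 0)"
    and "2 * of_bool (x \<in> K - {0} - nonzero_squares K) = 1 - chi x - of_bool (x = 0)"
  using assms nonzero_squares_subset by (auto simp: chi_def)

text \<open>
  \<open>h\<^sub>1\<close> and \<open>h\<^sub>2\<close> are the two signed indicators, both negated if \<open>L \<in> X 4\<close>; this makes the two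
  cases of the theorem one.
\<close>

lemma intersection_counts:
  fixes h\<^sub>1 h\<^sub>2 :: "'a \<Rightarrow> int" and m :: int
  defines "g \<equiv> gauss_sum p f (quadratic_char K)"
  assumes q: "int q = 2 * m ^ 2 - 1" and g0: "g \<noteq> 0"
    and h: "\<And>c z. c \<in> K \<Longrightarrow> h\<^sub>1 (c * z) = chi c * h\<^sub>1 z" "\<And>c z. c \<in> K \<Longrightarrow> h\<^sub>2 (c * z) = chi c * h\<^sub>2 z"
    and vals: "\<And>z. z \<noteq> 0 \<Longrightarrow> (h\<^sub>1 z, h\<^sub>2 z) \<in> {(1, 0), (- 1, 0), (0, 1), (0, - 1)}"
    and L: "L \<notin> K" "h\<^sub>2 L = 1"
    and fourier:
      "\<And>z \<kappa>. z \<noteq> 0 \<Longrightarrow> \<kappa> \<in> {1 / (L ^ q - L), - 1 / (L ^ q - L)} \<Longrightarrow>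
         (\<Sum>x\<in>UNIV. of_int (h\<^sub>1 x) * add_char p (2 * f) (\<kappa> * z ^ q * x))
           = g * of_int (- m * h\<^sub>1 z - (m - 1) * h\<^sub>2 z)"
      "\<And>z \<kappa>. z \<noteq> 0 \<Longrightarrow> \<kappa> \<in> {1 / (L ^ q - L), - 1 / (L ^ q - L)} \<Longrightarrow>
         (\<Sum>x\<in>UNIV. of_int (h\<^sub>2 x) * add_char p (2 * f) (\<kappa> * z ^ q * x))
           = g * of_int (- (m + 1) * h\<^sub>1 z + m * h\<^sub>2 z)"
    and D: "D\<^sub>0 = {x \<in> K. h\<^sub>1 (1 + x * L) - h\<^sub>2 (1 + x * L) = 1}"
      "D\<^sub>1 = {x \<in> K. h\<^sub>1 (1 + x * L) + h\<^sub>2 (1 + x * L) = 1}"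
  shows "int (card D\<^sub>0) = m ^ 2 - m \<and>
    int (card D\<^sub>1) = m ^ 2 \<and>
    {int (card (D\<^sub>0 \<inter> translate (nonzero_squares K \<union> {0}) s)) +
          int (card (D\<^sub>1 \<inter> translate (nonzero_squares K) s)) | s. s \<in> K}
         = {m ^ 2 - m, m ^ 2} \<and>
    {int (card (D\<^sub>0 \<inter> translate (nonzero_squares K) s)) +
          int (card (D\<^sub>1 \<inter> translate ((K - {0}) - nonzero_squares K) s)) | s. s \<in> K}
         = {m ^ 2 - m, m ^ 2}"
proof -
  define a b where "a x = h\<^sub>1 (1 + x * L)" and "b x = h\<^sub>2 (1 + x * L)" for x
  define \<delta> where "\<delta> = L ^ q - L"
  have \<delta>: "\<delta> \<noteq> 0" "\<delta> ^ q = - \<delta>"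
    using L(1) by (simp_all add: \<delta>_def K_iff power_q_diff)
  have L_ne_0: "L \<noteq> 0"
    using L(1) by auto
  \<comment> \<open>The line \<open>1 + K L\<close> misses 0 since \<open>L\<close> lies outside
    \<open>K\<close>, so \<open>vals\<close> applies to all of its points.\<close>
  have line_ne_0: "1 + x * L \<noteq> 0" if "x \<in> K" for x
  proof
    assume "1 + x * L = 0"
    then have "x \<noteq> 0" "x * L = - 1"
      by (auto simp: add_eq_0_iff)
    then have "L = - 1 / x"
      by (metis nonzero_mult_div_cancel_left)
    with that L(1) show False
      by auto
  qed
  \<comment> \<open>The Fourier coefficient is taken at \<open>\<kappa> * v ^ q\<close>. As
    \<open>\<kappa> ^ q = - \<kappa>\<close>, its product with \<open>v\<close> has trace 0, and its
    product with \<open>u\<close> has trace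
    \<open>\<kappa> * (v ^ q * u - v * u ^ q)\<close>.\<close>
  have line:
    "(\<Sum>y\<in>K. h\<^sub>1 (u + y * v)) = - m * h\<^sub>1 v - (m - 1) * h\<^sub>2 v \<and>
     (\<Sum>y\<in>K. h\<^sub>2 (u + y * v)) = - (m + 1) * h\<^sub>1 v + m * h\<^sub>2 v"
    if v: "v \<noteq> 0" and \<kappa>: "\<kappa> \<in> {1 / \<delta>, - 1 / \<delta>}" and uv: "\<kappa> * (v ^ q * u - v * u ^ q) = 1" for u v \<kappa>
  proof -
    have "\<kappa> ^ q = - \<kappa>"
      using \<kappa> \<delta> by (auto simp: power_divide power_q_minus)
    then have "\<kappa> * v ^ q * v + (\<kappa> * v ^ q * v) ^ q = 0" "\<kappa> * v ^ q * u + (\<kappa> * v ^ q * u) ^ q = 1"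
      using uv by (simp_all only: power_mult_distrib power_q_power_q) (simp_all add: algebra_simps)
    note * = line_sum_eq_fourier[OF _ this(1) v this(2)]
    have "g * of_int (\<Sum>y\<in>K. h\<^sub>1 (u + y * v)) = g * of_int (- m * h\<^sub>1 v - (m - 1) * h\<^sub>2 v)"
      using *[of h\<^sub>1, OF h(1)] fourier(1)[OF v \<kappa>[unfolded \<delta>_def]] by (simp only: g_def)
    moreover have "g * of_int (\<Sum>y\<in>K. h\<^sub>2 (u + y * v)) = g * of_int (- (m + 1) * h\<^sub>1 v + m * h\<^sub>2 v)"
      using *[of h\<^sub>2, OF h(2)] fourier(2)[OF v \<kappa>[unfolded \<delta>_def]] by (simp only: g_def)
    ultimately show ?thesis
      using g0 by (simp only: mult_cancel_left of_int_eq_iff) blast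
  qed
  have "h\<^sub>1 L = 0"
    using vals[OF L_ne_0] L(2) by auto
  moreover have "1 / \<delta> * (L ^ q * 1 - L * 1 ^ q) = 1"
    using \<delta> by (simp add: \<delta>_def)
  ultimately have sums: "(\<Sum>x\<in>K. a x) = 1 - m" "(\<Sum>x\<in>K. b x) = m"
    using line[of L "1 / \<delta>" 1] L_ne_0 L(2) by (simp_all add: a_def b_def)
  have twisted: "(\<Sum>x\<in>K. a x * chi (x - s)) = - m * a s - (m - 1) * b s"
    "(\<Sum>x\<in>K. b x * chi (x - s)) = - (m + 1) * a s + m * b s - 1" if s: "s \<in> K" for s
  proof -
    have "- 1 / \<delta> * ((1 + s * L) ^ q * L - (1 + s * L) * L ^ q) = 1"
      using \<delta> s by (simp add: \<delta>_def power_q_add power_mult_distrib K_iff field_simps)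
    then show "(\<Sum>x\<in>K. a x * chi (x - s)) = - m * a s - (m - 1) * b s"
      "(\<Sum>x\<in>K. b x * chi (x - s)) = - (m + 1) * a s + m * b s - 1"
      using line[of "1 + s * L" "- 1 / \<delta>" L] line_ne_0[OF s] \<open>h\<^sub>1 L = 0\<close> L(2)
        sum_line_chi[of h\<^sub>1, OF h(1) s] sum_line_chi[of h\<^sub>2, OF h(2) s]
      by (simp_all add: a_def b_def)
  qed
  have D_sub: "D\<^sub>0 \<subseteq> K" "D\<^sub>1 \<subseteq> K"
    by (auto simp: D)
  have ab: "(a x, b x) \<in> {(1, 0), (- 1, 0), (0, 1), (0, - 1)}" if "x \<in> K" for x
    using vals line_ne_0[OF that] by (simp add: a_def b_def)
  \<comment> \<open>Exactly one of \<open>a x\<close>, \<open>b x\<close> is nonzero, and it is 1 or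
    \<open>- 1\<close>, so \<open>a x - b x\<close> and \<open>a x + b x\<close> are both
    signs.\<close>
  have ind: "2 * of_bool (x \<in> D\<^sub>0) = 1 + a x - b x" "2 * of_bool (x \<in> D\<^sub>1) = 1 + a x + b x"
    if "x \<in> K" for x
    using ab[OF that] that unfolding D by (auto simp flip: a_def b_def)
  have card_D: "int (card E) = (\<Sum>x\<in>K. of_bool (x \<in> E))" if "E \<subseteq> K" for E
    using that by (simp add: Int_absorb1)
  have "2 * int (card D\<^sub>0) = (\<Sum>x\<in>K. 1 + a x - b x)" "2 * int (card D\<^sub>1) = (\<Sum>x\<in>K. 1 + a x + b x)"
    unfolding card_D[OF D_sub(1)] card_D[OF D_sub(2)] sum_distrib_left
    by (auto intro!: sum.cong simp: ind simp del: sum_mult_of_bool_eq)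
  then have cards: "int (card D\<^sub>0) = m ^ 2 - m" "int (card D\<^sub>1) = m ^ 2"
    using q by (simp_all add: sum.distrib sum_subtractf sums card_K)
  have m: "m ^ 2 \<ge> 2"
    using q q_ge_3 by linarith
  have sum_delta: "(\<Sum>x\<in>K. F x * of_bool (x - s = 0)) = F s" if "s \<in> K" for F :: "'a \<Rightarrow> int" and s
    using that by (simp add: sum.delta of_bool_def if_distrib cong: if_cong)
  have sum_chi_shift: "(\<Sum>x\<in>K. chi (x - s)) = 0" if "s \<in> K" for s
    using sum_K_diff[OF that, of chi] sum_chi by simp
  have K_diff: "x - s \<in> K" if "x \<in> K" "s \<in> K" for x s
    using that by simp
  note sub = nonzero_squares_subset
  have first: "int (card (D\<^sub>0 \<inter> translate (nonzero_squares K \<union> {0}) s)) +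
      int (card (D\<^sub>1 \<inter> translate (nonzero_squares K) s)) = (if s \<in> D\<^sub>1 then m ^ 2 - m else m ^ 2)"
    (is "?A = _") if s: "s \<in> K" for s
  proof -
    have "4 * ?A = (\<Sum>x\<in>K. 2 * of_bool (x \<in> D\<^sub>0) * (2 * of_bool (x - s \<in> nonzero_squares K \<union> {0}))
        + 2 * of_bool (x \<in> D\<^sub>1) * (2 * of_bool (x - s \<in> nonzero_squares K)))"
      using sub s D_sub
      by (subst (1 2) card_inter_translate)
        (auto simp: sum_distrib_left sum.distrib mult_ac simp del: sum_mult_of_bool_eq sum_of_bool_mult_eq)
    also have "\<dots> = (\<Sum>x\<in>K. (1 + a x - b x) * (1 + chi (x - s) + of_bool (x - s = 0))
        + (1 + a x + b x) * (1 + chi (x - s) - of_bool (x - s = 0)))"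
      by (intro sum.cong refl) (simp only: ind of_bool_squares K_diff s)
    \<comment> \<open>The products of \<open>b x\<close> with \<open>chi (x - s)\<close> cancel
      between the two summands, so only the twisted sum of \<open>a\<close> enters.\<close>
    also have "\<dots> = (\<Sum>x\<in>K. 2 + 2 * a x + 2 * chi (x - s) + 2 * (a x * chi (x - s))
        - 2 * (b x * of_bool (x - s = 0)))"
      by (intro sum.cong refl) (simp only: algebra_simps)
    also have "\<dots> = 2 * int q + 2 * (1 - m) + 2 * (- m * a s - (m - 1) * b s) - 2 * b s"
      by (simp only: sum.distrib sum_subtractf sum_distrib_left[symmetric] sums twisted[OF s]
          sum_delta[OF s] sum_chi_shift[OF s] sum_constant card_K)
    finally have "2 * ?A = 2 * m ^ 2 - m - m * (a s + b s)"
      using q by (simp add: algebra_simps)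
    then show ?thesis
      using ab[OF s] s by (auto simp: D simp flip: a_def b_def)
  qed
  have second: "int (card (D\<^sub>0 \<inter> translate (nonzero_squares K) s)) +
      int (card (D\<^sub>1 \<inter> translate ((K - {0}) - nonzero_squares K) s)) = (if s \<in> D\<^sub>0 then m ^ 2 else m ^ 2 - m)"
    (is "?A = _") if s: "s \<in> K" for s
  proof -
    have "4 * ?A = (\<Sum>x\<in>K. 2 * of_bool (x \<in> D\<^sub>0) * (2 * of_bool (x - s \<in> nonzero_squares K))
        + 2 * of_bool (x \<in> D\<^sub>1) * (2 * of_bool (x - s \<in> K - {0} - nonzero_squares K)))"
      using sub s D_sub
      by (subst (1 2) card_inter_translate)
        (auto simp: sum_distrib_left sum.distrib mult_ac simp del: sum_mult_of_bool_eq sum_of_bool_mult_eq)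
    also have "\<dots> = (\<Sum>x\<in>K. (1 + a x - b x) * (1 + chi (x - s) - of_bool (x - s = 0))
        + (1 + a x + b x) * (1 - chi (x - s) - of_bool (x - s = 0)))"
      by (intro sum.cong refl) (simp only: ind of_bool_squares K_diff s)
    \<comment> \<open>Here the opposite signs of \<open>chi\<close> cancel the products with
      \<open>a x\<close> instead, leaving the twisted sum of \<open>b\<close>.\<close>
    also have "\<dots> = (\<Sum>x\<in>K. 2 + 2 * a x - 2 * (b x * chi (x - s))
        - 2 * ((1 + a x) * of_bool (x - s = 0)))"
      by (intro sum.cong refl) (simp only: algebra_simps)
    also have "\<dots> = 2 * int q + 2 * (1 - m) - 2 * (- (m + 1) * a s + m * b s - 1) - 2 * (1 + a s)"
      by (simp only: sum.distrib sum_subtractf sum_distrib_left[symmetric] sums twisted[OF s]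
          sum_delta[OF s] sum_constant card_K)
    finally have "2 * ?A = 2 * m ^ 2 - m + m * (a s - b s)"
      using q by (simp add: algebra_simps)
    then show ?thesis
      using ab[OF s] s by (auto simp: D simp flip: a_def b_def)
  qed
  \<comment> \<open>Both values are attained because \<open>D\<^sub>0\<close> and
    \<open>D\<^sub>1\<close> are nonempty proper subsets of \<open>K\<close>.\<close>
  have proper: "\<exists>s\<in>K. s \<in> E" "\<exists>s\<in>K. s \<notin> E" if "E \<subseteq> K" "0 < int (card E)" "int (card E) < int q" for E
    using that card_K by (auto simp: card_gt_0_iff dest: subset_antisym)
  have "m \<noteq> 0" "m \<noteq> 1" "m \<noteq> - 1"
    using m by auto
  \<comment> \<open>The second product is chosen because
    \<open>q - (m ^ 2 - m) = (m - 1) * (m + 2) + 1\<close>; \<open>m\<close> may be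
    negative.\<close>
  then have "m * (m - 1) > 0" "(m - 1) * (m + 2) \<ge> 0"
    by (auto simp: zero_less_mult_iff zero_le_mult_iff)
  then have "m ^ 2 - m > 0" "m ^ 2 - m < int q"
    unfolding q by (simp_all add: power2_eq_square algebra_simps)
  moreover have "0 < m ^ 2" "m ^ 2 < int q"
    using q m by auto
  ultimately have ex: "\<exists>s\<in>K. s \<in> D\<^sub>0" "\<exists>s\<in>K. s \<notin> D\<^sub>0" "\<exists>s\<in>K. s \<in> D\<^sub>1" "\<exists>s\<in>K. s \<notin> D\<^sub>1"
    using proper[OF D_sub(1)] proper[OF D_sub(2)] by (simp_all only: cards)
  have value_set: "{F s | s. s \<in> K} = {i, j}"
    if "\<And>s. s \<in> K \<Longrightarrow> F s = (if s \<in> E then i else j)" "\<exists>s\<in>K. s \<in> E" "\<exists>s\<in>K. s \<notin> E"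
    for F :: "'a \<Rightarrow> int" and E i j
  proof (intro equalityI subsetI)
    fix k
    assume "k \<in> {i, j}"
    with that show "k \<in> {F s | s. s \<in> K}"
      by (auto simp: Bex_def) metis+
  qed (use that(1) in auto)
  show ?thesis
    using cards value_set[OF first ex(3,4)] value_set[OF second ex(1,2)] by (simp only: insert_commute)
qed

end

section \<open>From the character table to line sums and intersection numbers\<close>

theorem theorem6p4:
  fixes m \<tau> l :: int
    and p f q :: nat
    and \<omega> :: "'a::{field,finite}"
    and X Y :: "nat \<Rightarrow> 'a set"
    and S\<^sub>0 S\<^sub>1 :: "'a set"
    and M g :: complex
    and D :: "'a set \<Rightarrow> 'a set"
  assumes "odd m"
    and "int q = 2 * m ^ 2 - 1"
    and "prime p" and "f > 0" and "q = p ^ f"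
    and "CARD('a) = q ^ 2"
    and "primitive_element \<omega>"
    and "X 0 = {0}"
    and "(\<Union>i\<in>{1..4}. X i) = UNIV - {0}"
    and "disjoint_family_on X {1..4}"
    and "\<forall>i\<in>{1..4}. X i \<noteq> {}"
    and "X 1 = (\<lambda>x. \<omega> powi (2 * m ^ 2) * x) ` X 3"
    and "X 2 = (\<lambda>x. \<omega> powi (2 * m ^ 2) * x) ` X 4"
    and "\<forall>i\<in>{1..4}. \<exists>J. X i = (\<Union>j\<in>J. cyclotomic_class \<omega> (4 * m ^ 2) j)"
    and "association_scheme UNIV 4 (\<lambda>i. {(x, y). x - y \<in> X i})"
    and "\<tau> \<in> {1, - 1}"
    and "Y 0 = {0}"
    and "\<forall>j\<in>{1..4}. Y j = (\<lambda>x. \<omega> powi (- (m ^ 2) * \<tau>) * x ^ q) ` X j"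
    and "g = gauss_sum p f (quadratic_char (GF q :: 'a set))"
    and "M = of_int m"
    and "\<forall>a\<in>Y 0. map (\<lambda>i. add_char_sum p (2 * f) a (X i)) [1, 2, 3, 4] =
      [M * (M ^ 2 - 1) * (M - 1), M * (M ^ 2 - 1) * (M + 1),
       M * (M ^ 2 - 1) * (M - 1), M * (M ^ 2 - 1) * (M + 1)]"
    and "\<forall>a\<in>Y 1. map (\<lambda>i. add_char_sum p (2 * f) a (X i)) [1, 2, 3, 4] =
      [(M ^ 2 + M - 1) / 2 - M / 2 * g, (- (M ^ 2) - M) / 2 - (M + 1) / 2 * g,
       (M ^ 2 + M - 1) / 2 + M / 2 * g, (- (M ^ 2) - M) / 2 + (M + 1) / 2 * g]"
    and "\<forall>a\<in>Y 2. map (\<lambda>i. add_char_sum p (2 * f) a (X i)) [1, 2, 3, 4] =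
      [(- (M ^ 2) + M) / 2 - (M - 1) / 2 * g, (M ^ 2 - M - 1) / 2 + M / 2 * g,
       (- (M ^ 2) + M) / 2 + (M - 1) / 2 * g, (M ^ 2 - M - 1) / 2 - M / 2 * g]"
    and "\<forall>a\<in>Y 3. map (\<lambda>i. add_char_sum p (2 * f) a (X i)) [1, 2, 3, 4] =
      [(M ^ 2 + M - 1) / 2 + M / 2 * g, (- (M ^ 2) - M) / 2 + (M + 1) / 2 * g,
       (M ^ 2 + M - 1) / 2 - M / 2 * g, (- (M ^ 2) - M) / 2 - (M + 1) / 2 * g]"
    and "\<forall>a\<in>Y 4. map (\<lambda>i. add_char_sum p (2 * f) a (X i)) [1, 2, 3, 4] =
      [(- (M ^ 2) + M) / 2 + (M - 1) / 2 * g, (M ^ 2 - M - 1) / 2 - M / 2 * g,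
       (- (M ^ 2) + M) / 2 - (M - 1) / 2 * g, (M ^ 2 - M - 1) / 2 + M / 2 * g]"
    and "\<not> (int q + 1) dvd l"
    and "\<omega> powi l \<in> X 2 \<union> X 4"
    and "\<omega> powi (l * int q) - \<omega> powi l \<in> cyclotomic_class \<omega> (4 * m ^ 2) (\<tau> * m ^ 2)"
    and "\<omega> powi l \<in> X 2 \<longrightarrow> S\<^sub>0 = X 1 \<union> X 4 \<and> S\<^sub>1 = X 1 \<union> X 2"
    and "\<omega> powi l \<in> X 4 \<longrightarrow> S\<^sub>0 = X 2 \<union> X 3 \<and> S\<^sub>1 = X 3 \<union> X 4"
    and "\<forall>S. D S = {x \<in> GF q. 1 + x * \<omega> powi l \<in> S}"
  shows "int (card (D S\<^sub>0)) = m ^ 2 - m \<and>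
    int (card (D S\<^sub>1)) = m ^ 2 \<and>
    {int (card (D S\<^sub>0 \<inter> translate (nonzero_squares (GF q) \<union> {0}) s)) +
          int (card (D S\<^sub>1 \<inter> translate (nonzero_squares (GF q)) s)) | s. s \<in> GF q}
         = {m ^ 2 - m, m ^ 2} \<and>
    {int (card (D S\<^sub>0 \<inter> translate (nonzero_squares (GF q)) s)) +
          int (card (D S\<^sub>1 \<inter> translate ((GF q - {0}) - nonzero_squares (GF q)) s)) | s. s \<in> GF q}
         = {m ^ 2 - m, m ^ 2}"
proof -
  note q_int = assms(2) and cover = assms(9) and disj = assms(10) and nonempty = assms(11)
    and X1 = assms(12) and X2 = assms(13)
    and g = assms(19) and M = assms(20) and rows = assms(21-25)
  have "odd (int q)"
    unfolding q_int by simp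
  then have "odd q"
    by simp
  interpret quadratic_extension p f q \<omega>
    by (rule quadratic_extension.intro[OF assms(3-7) \<open>odd q\<close>])
  define L where "L = \<omega> powi l"
  let ?Sq = "nonzero_squares K"
  have e: "4 * m ^ 2 = 2 * (int q + 1)"
    using q_int by simp
  have "2 * m ^ 2 = int (q + 1)"
    using q_int by simp
  then have n: "\<omega> powi (2 * m ^ 2) = \<omega> ^ (q + 1)"
    by (simp only: power_int_of_nat)
  have Sq_closed: "c * d \<in> ?Sq" "1 / c \<in> ?Sq" if "c \<in> ?Sq" "d \<in> ?Sq" for c d
    using that by (auto simp: mem_nonzero_squares_iff chi_mult chi_inverse)
  have X_scale: "c * x \<in> X i" if i: "i \<in> {1..4}" and c: "c \<in> ?Sq" and x: "x \<in> X i" for i c x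
  proof -
    obtain J where "X i = (\<Union>j\<in>J. cyclotomic_class \<omega> (4 * m ^ 2) j)"
      using bspec[OF assms(14) i] by (rule exE)
    then have J: "X i = (\<Union>j\<in>J. (\<lambda>c. \<omega> powi j * c) ` ?Sq)"
      by (simp only: cyclotomic_class_eq[OF e])
    with x obtain j d where "j \<in> J" "d \<in> ?Sq" "x = \<omega> powi j * d"
      by blast
    moreover from this have "c * x = \<omega> powi j * (c * d)" "c * d \<in> ?Sq"
      using Sq_closed c by simp_all
    ultimately show ?thesis
      unfolding J by blast
  qed
  have zero: "0 \<notin> X i" if "i \<in> {1..4}" for i
    using cover that by blast
  have X_disj: "X i \<inter> X j = {}" if "i \<in> {1..4}" "j \<in> {1..4}" "i \<noteq> j" for i j
    using disj that unfolding disjoint_family_on_def by blast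
  have disjs: "X 1 \<inter> X 2 = {}" "X 1 \<inter> X 3 = {}" "X 1 \<inter> X 4 = {}" "X 2 \<inter> X 3 = {}" "X 2 \<inter> X 4 = {}"
    "X 3 \<inter> X 4 = {}"
    by (rule X_disj; simp)+
  have X_cases: "z \<in> X 1 \<or> z \<in> X 2 \<or> z \<in> X 3 \<or> z \<in> X 4" if "z \<noteq> 0" for z
  proof -
    obtain i where "i \<in> {1..4}" "z \<in> X i"
      using cover \<open>z \<noteq> 0\<close> by blast
    moreover have "{1..4::nat} = {1, 2, 3, 4}"
      by auto
    ultimately show ?thesis
      by (metis empty_iff insert_iff)
  qed
  \<comment> \<open>The sign makes the second indicator equal to 1 at \<open>L\<close> in both
    cases.\<close>
  define \<epsilon> :: int where "\<epsilon> = (if L \<in> X 2 then 1 else - 1)"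
  define k\<^sub>1 k\<^sub>2 :: "'a \<Rightarrow> int"
    where "k\<^sub>1 z = of_bool (z \<in> X 1) - of_bool (z \<in> X 3)"
      and "k\<^sub>2 z = of_bool (z \<in> X 2) - of_bool (z \<in> X 4)" for z
  have k_scale: "k\<^sub>1 (c * z) = chi c * k\<^sub>1 z" "k\<^sub>2 (c * z) = chi c * k\<^sub>2 z" if "c \<in> K" for c z
    unfolding k\<^sub>1_def k\<^sub>2_def
    by (rule signed_indicator_scale[OF X_scale X_scale X1[unfolded n] that zero zero]; simp)
      (rule signed_indicator_scale[OF X_scale X_scale X2[unfolded n] that zero zero]; simp)
  have k_simps: "z \<in> X 1 \<Longrightarrow> k\<^sub>1 z = 1 \<and> k\<^sub>2 z = 0" "z \<in> X 3 \<Longrightarrow> k\<^sub>1 z = - 1 \<and> k\<^sub>2 z = 0"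
    "z \<in> X 2 \<Longrightarrow> k\<^sub>1 z = 0 \<and> k\<^sub>2 z = 1" "z \<in> X 4 \<Longrightarrow> k\<^sub>1 z = 0 \<and> k\<^sub>2 z = - 1" for z
    using disjs by (auto simp: k\<^sub>1_def k\<^sub>2_def)
  \<comment> \<open>Oddness of \<open>m\<close> enters here: it makes \<open>- 1\<close> a square in
    \<open>K\<close>, so both signs of \<open>\<kappa>\<close> lie in the same coset of the
    squares.\<close>
  have "4 dvd q - 1"
  proof -
    obtain i where "m = 2 * i + 1"
      using \<open>odd m\<close> by (rule oddE)
    then have "int q - 1 = 4 * (2 * i ^ 2 + 2 * i)"
      using q_int by (simp add: power2_eq_square algebra_simps)
    then have "4 dvd int (q - 1)"
      using q_ge_3 by (simp add: of_nat_diff)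
    then show ?thesis
      by presburger
  qed
  then have minus_one: "- 1 \<in> ?Sq"
    using chi_minus_one by (simp add: mem_nonzero_squares_iff)
  have "L ^ q - L = \<omega> powi (l * int q) - \<omega> powi l"
    by (simp add: L_def power_int_power')
  then obtain c where c: "c \<in> ?Sq" "L ^ q - L = \<omega> powi (\<tau> * m ^ 2) * c"
    using assms(28) unfolding cyclotomic_class_eq[OF e] by auto
  \<comment> \<open>\<open>\<kappa>\<close> is \<open>\<omega> powi (- (m ^ 2) * \<tau>)\<close>
    times a square \<open>d\<close> of \<open>K\<close>. Since \<open>d = d ^ q\<close>, this factor
    can be moved into \<open>z\<close>, and \<open>d * z\<close> stays in
    \<open>X j\<close>.\<close>
  have in_Y: "\<kappa> * z ^ q \<in> Y j"
    if \<kappa>: "\<kappa> \<in> {1 / (L ^ q - L), - 1 / (L ^ q - L)}" and z: "z \<in> X j" and j: "j \<in> {1..4}" for \<kappa> z j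
  proof -
    have "\<exists>d\<in>?Sq. \<kappa> = \<omega> powi (- (m ^ 2) * \<tau>) * d"
    proof (cases "\<kappa> = 1 / (L ^ q - L)")
      case True
      then have "\<kappa> = \<omega> powi (- (m ^ 2) * \<tau>) * (1 / c)"
        by (simp add: c power_int_minus field_simps)
      then show ?thesis
        using Sq_closed(2) c(1) by blast
    next
      case False
      with \<kappa> have "\<kappa> = \<omega> powi (- (m ^ 2) * \<tau>) * (- 1 * (1 / c))"
        by (simp add: c power_int_minus field_simps)
      then show ?thesis
        using Sq_closed minus_one c(1) by blast
    qed
    then obtain d where d: "d \<in> ?Sq" "\<kappa> = \<omega> powi (- (m ^ 2) * \<tau>) * d"
      by blast
    then have "d ^ q = d"
      using nonzero_squares_subset K_iff by blast
    then have "\<kappa> * z ^ q = \<omega> powi (- (m ^ 2) * \<tau>) * (d * z) ^ q"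
      by (simp add: d(2) power_mult_distrib)
    moreover have "d * z \<in> X j"
      using X_scale j d(1) z by blast
    ultimately show ?thesis
      using assms(18) j by blast
  qed
  define F where "F i a = add_char_sum p (2 * f) a (X i)" for i a
  have F_diff: "(\<Sum>x\<in>UNIV. of_int (k\<^sub>1 x) * add_char p (2 * f) (a * x)) = F 1 a - F 3 a"
    "(\<Sum>x\<in>UNIV. of_int (k\<^sub>2 x) * add_char p (2 * f) (a * x)) = F 2 a - F 4 a" for a
    by (simp_all add: k\<^sub>1_def k\<^sub>2_def F_def add_char_sum_def left_diff_distrib sum_subtractf)
  \<comment> \<open>In every row of the table the first and third entries share their part without
    \<open>g\<close>, as do the second and fourth, so the differences are multiples of
    \<open>g\<close>.\<close>
  have F_diff_Y:
    "F 1 (\<kappa> * z ^ q) - F 3 (\<kappa> * z ^ q) = g * of_int (- m * k\<^sub>1 z - (m - 1) * k\<^sub>2 z) \<and>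
     F 2 (\<kappa> * z ^ q) - F 4 (\<kappa> * z ^ q) = g * of_int (- (m + 1) * k\<^sub>1 z + m * k\<^sub>2 z)"
    if "z \<noteq> 0" and \<kappa>: "\<kappa> \<in> {1 / (L ^ q - L), - 1 / (L ^ q - L)}" for z \<kappa>
    using X_cases[OF \<open>z \<noteq> 0\<close>]
  proof (elim disjE)
    assume z: "z \<in> X 1"
    then have "\<kappa> * z ^ q \<in> Y 1"
      using in_Y[OF \<kappa>] by simp
    from bspec[OF rows(2) this] show ?thesis
      using k_simps(1)[OF z] by (simp add: F_def M; simp add: field_simps)
  next
    assume z: "z \<in> X 2"
    then have "\<kappa> * z ^ q \<in> Y 2"
      using in_Y[OF \<kappa>] by simp
    from bspec[OF rows(3) this] show ?thesis
      using k_simps(3)[OF z] by (simp add: F_def M; simp add: field_simps)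
  next
    assume z: "z \<in> X 3"
    then have "\<kappa> * z ^ q \<in> Y 3"
      using in_Y[OF \<kappa>] by simp
    from bspec[OF rows(4) this] show ?thesis
      using k_simps(2)[OF z] by (simp add: F_def M; simp add: field_simps)
  next
    assume z: "z \<in> X 4"
    then have "\<kappa> * z ^ q \<in> Y 4"
      using in_Y[OF \<kappa>] by simp
    from bspec[OF rows(5) this] show ?thesis
      using k_simps(4)[OF z] by (simp add: F_def M; simp add: field_simps)
  qed
  \<comment> \<open>Nontriviality is read off the table: a trivial character would give equal row
    sums, but the row of \<open>Y 0\<close> sums to the even number
    \<open>4 * m ^ 2 * (m ^ 2 - 1)\<close> and that of \<open>Y 1\<close> to
    \<open>- 1\<close>.\<close>
  have "\<exists>a\<in>K. add_char p f a \<noteq> 1"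
  proof (rule ccontr)
    assume "\<not> ?thesis"
    then have "F i a = of_nat (card (X i))" for i a
      by (simp add: F_def add_char_sum_def add_char_extension)
    moreover obtain y where "y \<in> Y 1"
      using nonempty assms(18) by fastforce
    moreover have "(F 1 0 + F 3 0) + (F 2 0 + F 4 0) = 4 * M ^ 2 * (M ^ 2 - 1)"
      using bspec[OF rows(1), of 0] assms(17)
      by (simp add: F_def; simp add: power2_eq_square algebra_simps)
    moreover have "(F 1 y + F 3 y) + (F 2 y + F 4 y) = - 1"
      using bspec[OF rows(2) \<open>y \<in> Y 1\<close>] by (simp add: F_def; simp add: field_simps)
    ultimately have "4 * M ^ 2 * (M ^ 2 - 1) = - 1"
      by simp
    then have "of_int (4 * m ^ 2 * (m ^ 2 - 1)) = (of_int (- 1) :: complex)"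
      by (simp add: M)
    then have "4 * m ^ 2 * (m ^ 2 - 1) = - 1"
      by (simp only: of_int_eq_iff)
    then have "even (- 1 :: int)"
      by (metis dvd_mult2 even_numeral)
    then show False
      by simp
  qed
  then have g0: "g \<noteq> 0"
    unfolding g using gauss_sum_nonzero by blast
  have L_X: "L \<in> X 2 \<or> L \<in> X 4" and LK: "L \<notin> K"
    using assms(26,27) by (simp_all add: L_def omega_powi_in_K_iff add.commute)
  have D: "D S = {x \<in> K. 1 + x * L \<in> S}" for S
    using assms(31) by (simp add: L_def)
  \<comment> \<open>Negating both indicators exchanges \<open>X 1\<close> with \<open>X 3\<close>
    and \<open>X 2\<close> with \<open>X 4\<close>, which is how the two choices of
    \<open>S\<^sub>0\<close> and \<open>S\<^sub>1\<close> differ.\<close>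
  have S_iff: "z \<in> S\<^sub>0 \<longleftrightarrow> \<epsilon> * k\<^sub>1 z - \<epsilon> * k\<^sub>2 z = 1" "z \<in> S\<^sub>1 \<longleftrightarrow> \<epsilon> * k\<^sub>1 z + \<epsilon> * k\<^sub>2 z = 1" for z
    using L_X assms(29,30) disjs unfolding L_def[symmetric]
    by (auto simp: \<epsilon>_def k\<^sub>1_def k\<^sub>2_def of_bool_def split: if_splits)
  show ?thesis
    unfolding D
  proof (rule intersection_counts[of m "\<lambda>z. \<epsilon> * k\<^sub>1 z" "\<lambda>z. \<epsilon> * k\<^sub>2 z" L])
    show "(\<epsilon> * k\<^sub>1 z, \<epsilon> * k\<^sub>2 z) \<in> {(1, 0), (- 1, 0), (0, 1), (0, - 1)}" if "z \<noteq> 0" for z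
      using X_cases[OF that] k_simps[of z] by (auto simp: \<epsilon>_def)
    show "\<epsilon> * k\<^sub>2 L = 1"
      using L_X disjs k_simps by (auto simp: \<epsilon>_def)
    fix z \<kappa> :: 'a
    assume z\<kappa>: "z \<noteq> 0" "\<kappa> \<in> {1 / (L ^ q - L), - 1 / (L ^ q - L)}"
    \<comment> \<open>Both sides are linear in the pair of indicators, so the sign
      \<open>\<epsilon>\<close> passes through.\<close>
    have "(\<Sum>x\<in>UNIV. of_int (\<epsilon> * k\<^sub>1 x) * add_char p (2 * f) (\<kappa> * z ^ q * x))
        = of_int \<epsilon> * (F 1 (\<kappa> * z ^ q) - F 3 (\<kappa> * z ^ q))"
      by (simp only: of_int_mult mult.assoc[of "of_int \<epsilon>"] F_diff flip: sum_distrib_left)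
    also have "\<dots> = g * of_int (- m * (\<epsilon> * k\<^sub>1 z) - (m - 1) * (\<epsilon> * k\<^sub>2 z))"
      unfolding conjunct1[OF F_diff_Y[OF z\<kappa>]] by (simp add: algebra_simps)
    finally show "(\<Sum>x\<in>UNIV. of_int (\<epsilon> * k\<^sub>1 x) * add_char p (2 * f) (\<kappa> * z ^ q * x))
        = gauss_sum p f (quadratic_char K) * of_int (- m * (\<epsilon> * k\<^sub>1 z) - (m - 1) * (\<epsilon> * k\<^sub>2 z))"
      unfolding g .
    have "(\<Sum>x\<in>UNIV. of_int (\<epsilon> * k\<^sub>2 x) * add_char p (2 * f) (\<kappa> * z ^ q * x))
        = of_int \<epsilon> * (F 2 (\<kappa> * z ^ q) - F 4 (\<kappa> * z ^ q))"
      by (simp only: of_int_mult mult.assoc[of "of_int \<epsilon>"] F_diff flip: sum_distrib_left)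
    also have "\<dots> = g * of_int (- (m + 1) * (\<epsilon> * k\<^sub>1 z) + m * (\<epsilon> * k\<^sub>2 z))"
      unfolding conjunct2[OF F_diff_Y[OF z\<kappa>]] by (simp add: algebra_simps)
    finally show "(\<Sum>x\<in>UNIV. of_int (\<epsilon> * k\<^sub>2 x) * add_char p (2 * f) (\<kappa> * z ^ q * x))
        = gauss_sum p f (quadratic_char K) * of_int (- (m + 1) * (\<epsilon> * k\<^sub>1 z) + m * (\<epsilon> * k\<^sub>2 z))"
      unfolding g .
  qed (use q_int g0 g k_scale LK S_iff in \<open>simp_all add: mult_ac\<close>)
qed

end
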